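(* For every derivation in $\mathsf{SKSgq}$ with premise $Q$ and conclusion $P$ there exists a derivation in $\mathsf{GS1}+\mathsf{Cut}$ with premise $\vdash\underline{Q}_{G}$ and conclusion $\vdash\underline{P}_{G}$.
   Context: First-order terms are as usual; atoms are expressions $p(t_1,\dots,t_n)$ with $p$ a predicate symbol of arity $n$, and the negation of an atom is again an atom. Structures: $S ::= \mathsf f \mid \mathsf t \mid a \mid [S,\dots,S] \mid (S,\dots,S) \mid \bar S \mid \exists x S \mid \forall x S$ (non-empty lists), with $[\cdot]$ disjunction, $(\cdot)$ conjunction, $\bar S$ negation. A context $S\{\ \}$ is a structure with one occurrence of a hole, not in the scope of a negation; $S\{R\}$ fills the hole with $R$ (quantifiers of $S$ may capture variables of $R$); $S[R,T]$ abbreviates $S\{[R,T]\}$, $S(R,T)$ abbreviates $S\{(R,T)\}$. $R[x/t]$ denotes substitution of the term $t$ for $x$ in $R$, where $t$ must be free for $x$ in $R$. Equivalent structures are not distinguished; equivalence is the smallest equivalence relation induced by: $[\vec R,[\vec T],\vec U]=[\vec R,\vec T,\vec U]$, $(\vec R,(\vec T),\vec U)=(\vec R,\vec T,\vec U)$ ($\vec T$ non-empty); $[R,T]=[T,R]$, $(R,T)=(T,R)$; $(\mathsf f,\mathsf f)=\mathsf f$, $[\mathsf f,R]=R$, $[\mathsf t,\mathsf t]=\mathsf t$, $(\mathsf t,R)=R$; $\bar{\mathsf f}=\mathsf t$, $\bar{\mathsf t}=\mathsf f$, $\overline{[R,T]}=(\bar R,\bar T)$, $\overline{(R,T)}=[\bar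 R,\bar T]$, $\bar{\bar R}=R$, $\overline{\exists xR}=\forall x\bar R$, $\overline{\forall xR}=\exists x\bar R$; $\forall xR=\forall yR[x/y]$ and $\exists xR=\exists yR[x/y]$ if $y$ is not free in $R$; $\forall yR=\exists yR=R$ if $y$ is not free in $R$; and closure: if $R=T$ then $S\{R\}=S\{T\}$ and $\bar R=\bar T$. A derivation in a system (set of inference rules) is a finite sequence of rule instances, read top-down, the conclusion of each being the premise of the next; it may consist of a single structure. Its premise is the topmost structure, its conclusion the bottommost. System $\mathsf{SKSgq}$ has the rules (written $\frac{\text{premise}}{\text{conclusion}}$): $i{\downarrow}:\frac{S\{\mathsf t\}}{S[R,\bar R]}$, $i{\uparrow}:\frac{S(R,\bar R)}{S\{\mathsf f\}}$, $s:\frac{S([R,U],T)}{S[(R,T),U]}$, $w{\downarrow}:\frac{S\{\mathsf f\}}{S\{R\}}$, $w{\uparrow}:\frac{S\{R\}}{S\{\mathsf t\}}$, $c{\downarrow}:\frac{S[R,R]}{S\{R\}}$, $c{\uparrow}:\frac{S\{R\}}{S(R,R)}$, $u{\downarrow}:\frac{S\{\forall x[R,T]\}}{S[\forall xR,\exists xT]}$, $u{\uparrow}:\frac{S(\exists xR,\forall xT)}{S\{\exists x(R,T)\}}$, $n{\downarrow}:\frac{S\{R[x/t]\}}{S\{\exists xR\}}$, $n{\uparrow}:\frac{S\{\forall xR\}}{S\{R[x/t]\}}$. Sequent system: formulae are built from atoms (closed under negation) and constants $\top,\bot$ with $\wedge,\vee,\exists,\forall$; negation occurs only on atoms and $\bar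 A$ is the De Morgan dual of $A$. Sequents are finite multisets of formulae. $\mathsf{GS1}+\mathsf{Cut}$ has the rules: $\top$: infer $\vdash\top$; $\mathsf{Ax}$: infer $\vdash A,\bar A$; $\mathsf R\wedge$: from $\vdash\Phi,A$ and $\vdash\Psi,B$ infer $\vdash\Phi,\Psi,A\wedge B$; $\mathsf R\vee$: from $\vdash\Phi,A,B$ infer $\vdash\Phi,A\vee B$; $\mathsf{RC}$: from $\vdash\Phi,A,A$ infer $\vdash\Phi,A$; $\mathsf{RW}$: from $\vdash\Phi$ infer $\vdash\Phi,A$; $\mathsf R\exists$: from $\vdash\Phi,A[x/t]$ infer $\vdash\Phi,\exists xA$; $\mathsf R\forall$: from $\vdash\Phi,A[x/y]$ infer $\vdash\Phi,\forall xA$, provided $y$ is not free in the conclusion; $\mathsf{Cut}$: from $\vdash\Phi,A$ and $\vdash\Psi,\bar A$ infer $\vdash\Phi,\Psi$. Derivations are trees built by these rules; the premises are the open leaves (not closed by an axiom). For the translation, structures are assumed to contain negation only on atoms and only conjunctions and disjunctions of exactly two structures (every structure is equivalent to such a one). Translation: $\underline a_G=a$, $\underline{\mathsf t}_G=\top$, $\underline{\mathsf f}_G=\bot$, $\underline{[R,T]}_G=\underline R_G\vee\underline T_G$, $\underline{(R,T)}_G=\underline R_G\wedge\underline T_G$, $\underline{\exists xS}_G=\exists x\underline S_G$, $\underline{\forall xS}_G=\forall x\underline S_G$. *)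

theory Defs
  imports Main "HOL-Library.Multiset"
begin

section \<open>Terms and atoms over a first-order signature\<close>

record ('f, 'p) signature =
  fun_arity :: "'f \<Rightarrow> nat"
  pred_arity :: "'p \<Rightarrow> nat"

text \<open>Arities are not enforced by the datatypes below; the predicates \<open>wf_trm\<close>, \<open>wf_atom\<close>,
  \<open>wf_str\<close> and \<open>wf_form\<close> single out the expressions of the language given by a signature.\<close>

datatype 'f trm = Var nat | Fun 'f "'f trm list"

fun wf_trm :: "('f, 'p) signature \<Rightarrow> 'f trm \<Rightarrow> bool" where
  "wf_trm \<Sigma> (Var x) \<longleftrightarrow> True"
| "wf_trm \<Sigma> (Fun f ts) \<longleftrightarrow> length ts = fun_arity \<Sigma> f \<and> (\<forall>t\<in>set ts. wf_trm \<Sigma> t)"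

fun vars_trm :: "'f trm \<Rightarrow> nat set" where
  "vars_trm (Var x) = {x}"
| "vars_trm (Fun f ts) = (\<Union>t\<in>set ts. vars_trm t)"

fun subst_trm :: "nat \<Rightarrow> 'f trm \<Rightarrow> 'f trm \<Rightarrow> 'f trm" where
  "subst_trm x t (Var y) = (if y = x then t else Var y)"
| "subst_trm x t (Fun f ts) = Fun f (map (subst_trm x t) ts)"

text \<open>Atoms are signed, so that the negation of an atom is again an atom.\<close>

datatype ('f, 'p) atom = Pos 'p "'f trm list" | Neg 'p "'f trm list"

fun neg_atom :: "('f, 'p) atom \<Rightarrow> ('f, 'p) atom" where
  "neg_atom (Pos p ts) = Neg p ts"
| "neg_atom (Neg p ts) = Pos p ts"

fun wf_atom :: "('f, 'p) signature \<Rightarrow> ('f, 'p) atom \<Rightarrow> bool" where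
  "wf_atom \<Sigma> (Pos p ts) \<longleftrightarrow> length ts = pred_arity \<Sigma> p \<and> (\<forall>t\<in>set ts. wf_trm \<Sigma> t)"
| "wf_atom \<Sigma> (Neg p ts) \<longleftrightarrow> length ts = pred_arity \<Sigma> p \<and> (\<forall>t\<in>set ts. wf_trm \<Sigma> t)"

fun vars_atom :: "('f, 'p) atom \<Rightarrow> nat set" where
  "vars_atom (Pos p ts) = (\<Union>t\<in>set ts. vars_trm t)"
| "vars_atom (Neg p ts) = (\<Union>t\<in>set ts. vars_trm t)"

fun subst_atom :: "nat \<Rightarrow> 'f trm \<Rightarrow> ('f, 'p) atom \<Rightarrow> ('f, 'p) atom" where
  "subst_atom x t (Pos p ts) = Pos p (map (subst_trm x t) ts)"
| "subst_atom x t (Neg p ts) = Neg p (map (subst_trm x t) ts)"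


section \<open>Structures\<close>

datatype ('f, 'p) str =
    Ff
  | Tt
  | At "('f, 'p) atom"
  | Disj "('f, 'p) str list"
  | Conj "('f, 'p) str list"
  | Bar "('f, 'p) str"
  | SEx nat "('f, 'p) str"
  | SAll nat "('f, 'p) str"

text \<open>Well-formedness includes that disjunctions and conjunctions are over non-empty lists.\<close>

fun wf_str :: "('f, 'p) signature \<Rightarrow> ('f, 'p) str \<Rightarrow> bool" where
  "wf_str \<Sigma> Ff \<longleftrightarrow> True"
| "wf_str \<Sigma> Tt \<longleftrightarrow> True"
| "wf_str \<Sigma> (At a) \<longleftrightarrow> wf_atom \<Sigma> a"
| "wf_str \<Sigma> (Disj Rs) \<longleftrightarrow> Rs \<noteq> [] \<and> (\<forall>R\<in>set Rs. wf_str \<Sigma> R)"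
| "wf_str \<Sigma> (Conj Rs) \<longleftrightarrow> Rs \<noteq> [] \<and> (\<forall>R\<in>set Rs. wf_str \<Sigma> R)"
| "wf_str \<Sigma> (Bar R) \<longleftrightarrow> wf_str \<Sigma> R"
| "wf_str \<Sigma> (SEx x R) \<longleftrightarrow> wf_str \<Sigma> R"
| "wf_str \<Sigma> (SAll x R) \<longleftrightarrow> wf_str \<Sigma> R"

fun fv_str :: "('f, 'p) str \<Rightarrow> nat set" where
  "fv_str Ff = {}"
| "fv_str Tt = {}"
| "fv_str (At a) = vars_atom a"
| "fv_str (Disj Rs) = (\<Union>R\<in>set Rs. fv_str R)"
| "fv_str (Conj Rs) = (\<Union>R\<in>set Rs. fv_str R)"
| "fv_str (Bar R) = fv_str R"
| "fv_str (SEx x R) = fv_str R - {x}"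
| "fv_str (SAll x R) = fv_str R - {x}"

text \<open>\<open>subst_str x t R\<close> is $R[x/t]$.  It may capture variables of \<open>t\<close>, so every use is guarded
  by \<open>free_for_str t x R\<close>.\<close>

fun subst_str :: "nat \<Rightarrow> 'f trm \<Rightarrow> ('f, 'p) str \<Rightarrow> ('f, 'p) str" where
  "subst_str x t Ff = Ff"
| "subst_str x t Tt = Tt"
| "subst_str x t (At a) = At (subst_atom x t a)"
| "subst_str x t (Disj Rs) = Disj (map (subst_str x t) Rs)"
| "subst_str x t (Conj Rs) = Conj (map (subst_str x t) Rs)"
| "subst_str x t (Bar R) = Bar (subst_str x t R)"
| "subst_str x t (SEx y R) = SEx y (if y = x then R else subst_str x t R)"
| "subst_str x t (SAll y R) = SAll y (if y = x then R else subst_str x t R)"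

fun free_for_str :: "'f trm \<Rightarrow> nat \<Rightarrow> ('f, 'p) str \<Rightarrow> bool" where
  "free_for_str t x Ff \<longleftrightarrow> True"
| "free_for_str t x Tt \<longleftrightarrow> True"
| "free_for_str t x (At a) \<longleftrightarrow> True"
| "free_for_str t x (Disj Rs) \<longleftrightarrow> (\<forall>R\<in>set Rs. free_for_str t x R)"
| "free_for_str t x (Conj Rs) \<longleftrightarrow> (\<forall>R\<in>set Rs. free_for_str t x R)"
| "free_for_str t x (Bar R) \<longleftrightarrow> free_for_str t x R"
| "free_for_str t x (SEx y R) \<longleftrightarrow>
     x \<notin> fv_str (SEx y R) \<or> (y \<notin> vars_trm t \<and> free_for_str t x R)"
| "free_for_str t x (SAll y R) \<longleftrightarrow>
     x \<notin> fv_str (SAll y R) \<or> (y \<notin> vars_trm t \<and> free_for_str t x R)"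

text \<open>There is no context former for negation: the hole is never in the scope of one.\<close>

datatype ('f, 'p) ctx =
    Hole
  | CDisj "('f, 'p) str list" "('f, 'p) ctx" "('f, 'p) str list"
  | CConj "('f, 'p) str list" "('f, 'p) ctx" "('f, 'p) str list"
  | CEx nat "('f, 'p) ctx"
  | CAll nat "('f, 'p) ctx"

fun fill :: "('f, 'p) ctx \<Rightarrow> ('f, 'p) str \<Rightarrow> ('f, 'p) str" where
  "fill Hole R = R"
| "fill (CDisj Rs S Us) R = Disj (Rs @ fill S R # Us)"
| "fill (CConj Rs S Us) R = Conj (Rs @ fill S R # Us)"
| "fill (CEx x S) R = SEx x (fill S R)"
| "fill (CAll x S) R = SAll x (fill S R)"

text \<open>Both sides of each equation contain the same empty lists and the same arity violations, so
  the relation never relates a well-formed structure to an ill-formed one.  The equation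
  \<open>neg_At\<close> states that the bar on an atom is the negation of atoms.\<close>

inductive str_equiv :: "('f, 'p) str \<Rightarrow> ('f, 'p) str \<Rightarrow> bool" (infix "\<simeq>" 50) where
  refl: "R \<simeq> R"
| sym: "R \<simeq> T \<Longrightarrow> T \<simeq> R"
| trans: "R \<simeq> T \<Longrightarrow> T \<simeq> U \<Longrightarrow> R \<simeq> U"
| Disj_assoc: "Ts \<noteq> [] \<Longrightarrow> Disj (Rs @ Disj Ts # Us) \<simeq> Disj (Rs @ Ts @ Us)"
| Conj_assoc: "Ts \<noteq> [] \<Longrightarrow> Conj (Rs @ Conj Ts # Us) \<simeq> Conj (Rs @ Ts @ Us)"
| Disj_comm: "Disj [R, T] \<simeq> Disj [T, R]"
| Conj_comm: "Conj [R, T] \<simeq> Conj [T, R]"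
| Conj_ff: "Conj [Ff, Ff] \<simeq> Ff"
| Disj_unit: "Disj [Ff, R] \<simeq> R"
| Disj_tt: "Disj [Tt, Tt] \<simeq> Tt"
| Conj_unit: "Conj [Tt, R] \<simeq> R"
| neg_Ff: "Bar Ff \<simeq> Tt"
| neg_Tt: "Bar Tt \<simeq> Ff"
| neg_At: "Bar (At a) \<simeq> At (neg_atom a)"
| neg_Disj: "Bar (Disj [R, T]) \<simeq> Conj [Bar R, Bar T]"
| neg_Conj: "Bar (Conj [R, T]) \<simeq> Disj [Bar R, Bar T]"
| neg_neg: "Bar (Bar R) \<simeq> R"
| neg_SEx: "Bar (SEx x R) \<simeq> SAll x (Bar R)"
| neg_SAll: "Bar (SAll x R) \<simeq> SEx x (Bar R)"
| rename_SAll: "y \<notin> fv_str R \<Longrightarrow> free_for_str (Var y) x R \<Longrightarrow>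
    SAll x R \<simeq> SAll y (subst_str x (Var y) R)"
| rename_SEx: "y \<notin> fv_str R \<Longrightarrow> free_for_str (Var y) x R \<Longrightarrow>
    SEx x R \<simeq> SEx y (subst_str x (Var y) R)"
| vacuous_SAll: "y \<notin> fv_str R \<Longrightarrow> SAll y R \<simeq> R"
| vacuous_SEx: "y \<notin> fv_str R \<Longrightarrow> SEx y R \<simeq> R"
| ctx_closure: "R \<simeq> T \<Longrightarrow> fill S R \<simeq> fill S T"
| neg_closure: "R \<simeq> T \<Longrightarrow> Bar R \<simeq> Bar T"


section \<open>System SKSgq\<close>

text \<open>\<open>sksgq_rule A B\<close>: there is a rule instance with premise \<open>A\<close> and conclusion \<open>B\<close>.\<close>

inductive sksgq_rule :: "('f, 'p) str \<Rightarrow> ('f, 'p) str \<Rightarrow> bool" where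
  i_down: "sksgq_rule (fill S Tt) (fill S (Disj [R, Bar R]))"
| i_up: "sksgq_rule (fill S (Conj [R, Bar R])) (fill S Ff)"
| switch: "sksgq_rule (fill S (Conj [Disj [R, U], T])) (fill S (Disj [Conj [R, T], U]))"
| w_down: "sksgq_rule (fill S Ff) (fill S R)"
| w_up: "sksgq_rule (fill S R) (fill S Tt)"
| c_down: "sksgq_rule (fill S (Disj [R, R])) (fill S R)"
| c_up: "sksgq_rule (fill S R) (fill S (Conj [R, R]))"
| u_down: "sksgq_rule (fill S (SAll x (Disj [R, T]))) (fill S (Disj [SAll x R, SEx x T]))"
| u_up: "sksgq_rule (fill S (Conj [SEx x R, SAll x T])) (fill S (SEx x (Conj [R, T])))"
| n_down: "free_for_str t x R \<Longrightarrow> sksgq_rule (fill S (subst_str x t R)) (fill S (SEx x R))"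
| n_up: "free_for_str t x R \<Longrightarrow> sksgq_rule (fill S (SAll x R)) (fill S (subst_str x t R))"

text \<open>A derivation lists its structures from top (premise) to bottom (conclusion).  Since
  equivalent structures are not distinguished, a rule may be applied to, and yield, any
  structures equivalent to the listed ones.\<close>

definition sksgq_derivation ::
  "('f, 'p) signature \<Rightarrow> ('f, 'p) str list \<Rightarrow> bool" where
  "sksgq_derivation \<Sigma> \<Delta> \<longleftrightarrow>
     \<Delta> \<noteq> [] \<and> (\<forall>S\<in>set \<Delta>. wf_str \<Sigma> S) \<and>
     (\<forall>i. Suc i < length \<Delta> \<longrightarrow>
        (\<exists>A B. \<Delta> ! i \<simeq> A \<and> sksgq_rule A B \<and> B \<simeq> \<Delta> ! Suc i))"

definition sksgq_derivation_from_to ::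
  "('f, 'p) signature \<Rightarrow> ('f, 'p) str list \<Rightarrow> ('f, 'p) str \<Rightarrow> ('f, 'p) str \<Rightarrow> bool" where
  "sksgq_derivation_from_to \<Sigma> \<Delta> Q P \<longleftrightarrow>
     sksgq_derivation \<Sigma> \<Delta> \<and> hd \<Delta> \<simeq> Q \<and> last \<Delta> \<simeq> P"


section \<open>Formulae, sequents and system GS1 + Cut\<close>

datatype ('f, 'p) form =
    FAt "('f, 'p) atom"
  | FTop
  | FBot
  | FAnd "('f, 'p) form" "('f, 'p) form"
  | FOr "('f, 'p) form" "('f, 'p) form"
  | FEx nat "('f, 'p) form"
  | FAll nat "('f, 'p) form"

fun dual :: "('f, 'p) form \<Rightarrow> ('f, 'p) form" where
  "dual (FAt a) = FAt (neg_atom a)"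
| "dual FTop = FBot"
| "dual FBot = FTop"
| "dual (FAnd A B) = FOr (dual A) (dual B)"
| "dual (FOr A B) = FAnd (dual A) (dual B)"
| "dual (FEx x A) = FAll x (dual A)"
| "dual (FAll x A) = FEx x (dual A)"

fun wf_form :: "('f, 'p) signature \<Rightarrow> ('f, 'p) form \<Rightarrow> bool" where
  "wf_form \<Sigma> (FAt a) \<longleftrightarrow> wf_atom \<Sigma> a"
| "wf_form \<Sigma> FTop \<longleftrightarrow> True"
| "wf_form \<Sigma> FBot \<longleftrightarrow> True"
| "wf_form \<Sigma> (FAnd A B) \<longleftrightarrow> wf_form \<Sigma> A \<and> wf_form \<Sigma> B"
| "wf_form \<Sigma> (FOr A B) \<longleftrightarrow> wf_form \<Sigma> A \<and> wf_form \<Sigma> B"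
| "wf_form \<Sigma> (FEx x A) \<longleftrightarrow> wf_form \<Sigma> A"
| "wf_form \<Sigma> (FAll x A) \<longleftrightarrow> wf_form \<Sigma> A"

fun fv_form :: "('f, 'p) form \<Rightarrow> nat set" where
  "fv_form (FAt a) = vars_atom a"
| "fv_form FTop = {}"
| "fv_form FBot = {}"
| "fv_form (FAnd A B) = fv_form A \<union> fv_form B"
| "fv_form (FOr A B) = fv_form A \<union> fv_form B"
| "fv_form (FEx x A) = fv_form A - {x}"
| "fv_form (FAll x A) = fv_form A - {x}"

fun subst_form :: "nat \<Rightarrow> 'f trm \<Rightarrow> ('f, 'p) form \<Rightarrow> ('f, 'p) form" where
  "subst_form x t (FAt a) = FAt (subst_atom x t a)"
| "subst_form x t FTop = FTop"
| "subst_form x t FBot = FBot"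
| "subst_form x t (FAnd A B) = FAnd (subst_form x t A) (subst_form x t B)"
| "subst_form x t (FOr A B) = FOr (subst_form x t A) (subst_form x t B)"
| "subst_form x t (FEx y A) = FEx y (if y = x then A else subst_form x t A)"
| "subst_form x t (FAll y A) = FAll y (if y = x then A else subst_form x t A)"

fun free_for_form :: "'f trm \<Rightarrow> nat \<Rightarrow> ('f, 'p) form \<Rightarrow> bool" where
  "free_for_form t x (FAt a) \<longleftrightarrow> True"
| "free_for_form t x FTop \<longleftrightarrow> True"
| "free_for_form t x FBot \<longleftrightarrow> True"
| "free_for_form t x (FAnd A B) \<longleftrightarrow> free_for_form t x A \<and> free_for_form t x B"
| "free_for_form t x (FOr A B) \<longleftrightarrow> free_for_form t x A \<and> free_for_form t x B"
| "free_for_form t x (FEx y A) \<longleftrightarrow>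
     x \<notin> fv_form (FEx y A) \<or> (y \<notin> vars_trm t \<and> free_for_form t x A)"
| "free_for_form t x (FAll y A) \<longleftrightarrow>
     x \<notin> fv_form (FAll y A) \<or> (y \<notin> vars_trm t \<and> free_for_form t x A)"

type_synonym ('f, 'p) sequent = "('f, 'p) form multiset"

definition fv_sequent :: "('f, 'p) sequent \<Rightarrow> nat set" where
  "fv_sequent \<Phi> = (\<Union>A\<in>set_mset \<Phi>. fv_form A)"

text \<open>\<open>gs1cut_rule \<Gamma>s \<Phi>\<close>: there is a rule instance with premises \<open>\<Gamma>s\<close> and conclusion \<open>\<Phi>\<close>.\<close>

inductive gs1cut_rule :: "('f, 'p) sequent list \<Rightarrow> ('f, 'p) sequent \<Rightarrow> bool" where
  Top: "gs1cut_rule [] {#FTop#}"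
| Ax: "gs1cut_rule [] {#A, dual A#}"
| RAnd: "gs1cut_rule [add_mset A \<Phi>, add_mset B \<Psi>] (add_mset (FAnd A B) (\<Phi> + \<Psi>))"
| ROr: "gs1cut_rule [add_mset A (add_mset B \<Phi>)] (add_mset (FOr A B) \<Phi>)"
| RC: "gs1cut_rule [add_mset A (add_mset A \<Phi>)] (add_mset A \<Phi>)"
| RW: "gs1cut_rule [\<Phi>] (add_mset A \<Phi>)"
| REx: "free_for_form t x A \<Longrightarrow>
    gs1cut_rule [add_mset (subst_form x t A) \<Phi>] (add_mset (FEx x A) \<Phi>)"
| RAll: "free_for_form (Var y) x A \<Longrightarrow> y \<notin> fv_sequent (add_mset (FAll x A) \<Phi>) \<Longrightarrow>
    gs1cut_rule [add_mset (subst_form x (Var y) A) \<Phi>] (add_mset (FAll x A) \<Phi>)"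
| Cut: "gs1cut_rule [add_mset A \<Phi>, add_mset (dual A) \<Psi>] (\<Phi> + \<Psi>)"

text \<open>In a tree, \<open>Open\<close> marks a premise, while a leaf closed by an axiom is an \<open>Infer\<close> node
  without subtrees.\<close>

datatype ('f, 'p) tree =
    Open "('f, 'p) sequent"
  | Infer "('f, 'p) sequent" "('f, 'p) tree list"

fun conclusion :: "('f, 'p) tree \<Rightarrow> ('f, 'p) sequent" where
  "conclusion (Open \<Phi>) = \<Phi>"
| "conclusion (Infer \<Phi> Ds) = \<Phi>"

fun open_leaves :: "('f, 'p) tree \<Rightarrow> ('f, 'p) sequent list" where
  "open_leaves (Open \<Phi>) = [\<Phi>]"
| "open_leaves (Infer \<Phi> Ds) = concat (map open_leaves Ds)"

fun gs1cut_derivation :: "('f, 'p) signature \<Rightarrow> ('f, 'p) tree \<Rightarrow> bool" where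
  "gs1cut_derivation \<Sigma> (Open \<Phi>) \<longleftrightarrow> (\<forall>A\<in>set_mset \<Phi>. wf_form \<Sigma> A)"
| "gs1cut_derivation \<Sigma> (Infer \<Phi> Ds) \<longleftrightarrow>
     (\<forall>A\<in>set_mset \<Phi>. wf_form \<Sigma> A) \<and> gs1cut_rule (map conclusion Ds) \<Phi> \<and>
     (\<forall>D\<in>set Ds. gs1cut_derivation \<Sigma> D)"


section \<open>Translation of structures into formulae\<close>

text \<open>The structures to which the translation applies.  A negated atom may be written either
  as a signed atom or as a bar over an atom.\<close>

fun translatable :: "('f, 'p) str \<Rightarrow> bool" where
  "translatable Ff \<longleftrightarrow> True"
| "translatable Tt \<longleftrightarrow> True"
| "translatable (At a) \<longleftrightarrow> True"
| "translatable (Bar (At a)) \<longleftrightarrow> True"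
| "translatable (Disj [R, T]) \<longleftrightarrow> translatable R \<and> translatable T"
| "translatable (Conj [R, T]) \<longleftrightarrow> translatable R \<and> translatable T"
| "translatable (SEx x R) \<longleftrightarrow> translatable R"
| "translatable (SAll x R) \<longleftrightarrow> translatable R"
| "translatable _ \<longleftrightarrow> False"

fun to_form :: "('f, 'p) str \<Rightarrow> ('f, 'p) form" where
  "to_form Ff = FBot"
| "to_form Tt = FTop"
| "to_form (At a) = FAt a"
| "to_form (Bar (At a)) = FAt (neg_atom a)"
| "to_form (Disj [R, T]) = FOr (to_form R) (to_form T)"
| "to_form (Conj [R, T]) = FAnd (to_form R) (to_form T)"
| "to_form (SEx x R) = FEx x (to_form R)"
| "to_form (SAll x R) = FAll x (to_form R)"
| "to_form _ = undefined"

end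

theory Submission
  imports Defs
begin

text \<open>Order formulae by \<open>A \<le> B\<close> iff the sequent of the dual of \<open>A\<close> and \<open>B\<close> is provable without open
  premises.  This is a Boolean preorder in which quantifiers are bounds, equivalent structures
  have equivalent translations, and every rule of SKSgq goes up in the order, also inside a
  context.  A derivation from \<open>Q\<close> to \<open>P\<close> therefore yields a proof of the dual of \<open>Q\<close> together with
  \<open>P\<close>, and one cut against the open premise \<open>Q\<close> gives \<open>P\<close>.\<close>

section \<open>Duality and substitution\<close>

lemma neg_atom_neg_atom [simp]: "neg_atom (neg_atom a) = a"
  by (cases a) auto

lemma vars_atom_neg [simp]: "vars_atom (neg_atom a) = vars_atom a"
  by (cases a) auto

lemma wf_atom_neg [simp]: "wf_atom \<Sigma> (neg_atom a) = wf_atom \<Sigma> a"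
  by (cases a) auto

lemma subst_atom_neg [simp]: "subst_atom x t (neg_atom a) = neg_atom (subst_atom x t a)"
  by (cases a) auto

lemma dual_dual [simp]: "dual (dual A) = A"
  by (induction A) auto

lemma fv_form_dual [simp]: "fv_form (dual A) = fv_form A"
  by (induction A) auto

lemma wf_form_dual [simp]: "wf_form \<Sigma> (dual A) = wf_form \<Sigma> A"
  by (induction A) auto

lemma subst_form_dual [simp]: "subst_form x t (dual A) = dual (subst_form x t A)"
  by (induction A) auto

lemma free_for_form_dual [simp]: "free_for_form t x (dual A) = free_for_form t x A"
  by (induction A) auto

text \<open>These identities make a bound variable available as its own witness and as its own
  eigenvariable.\<close>

lemma subst_trm_Var_same [simp]: "subst_trm x (Var x) t = t"
  by (induction t) (auto simp: map_idI)

lemma subst_atom_Var_same [simp]: "subst_atom x (Var x) a = a"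
  by (cases a) (auto simp: map_idI)

lemma subst_form_Var_same [simp]: "subst_form x (Var x) A = A"
  by (induction A) auto

lemma free_for_form_Var_same [simp]: "free_for_form (Var x) x A"
  by (induction A) auto

lemma wf_trm_subst_Var [simp]: "wf_trm \<Sigma> (subst_trm x (Var y) t) = wf_trm \<Sigma> t"
  by (induction t) auto

lemma wf_atom_subst_Var [simp]: "wf_atom \<Sigma> (subst_atom x (Var y) a) = wf_atom \<Sigma> a"
  by (cases a) auto

lemma wf_form_subst_Var [simp]: "wf_form \<Sigma> (subst_form x (Var y) A) = wf_form \<Sigma> A"
  by (induction A) auto

lemma wf_str_subst_Var [simp]: "wf_str \<Sigma> (subst_str x (Var y) R) = wf_str \<Sigma> R"
  by (induction R) auto


section \<open>The provability order on formulae\<close>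

definition provable :: "('f, 'p) signature \<Rightarrow> ('f, 'p) sequent \<Rightarrow> bool" where
  "provable \<Sigma> \<Phi> \<longleftrightarrow>
     (\<exists>D. gs1cut_derivation \<Sigma> D \<and> open_leaves D = [] \<and> conclusion D = \<Phi>)"

lemma provable_rule:
  assumes "gs1cut_rule \<Gamma>s \<Phi>" and "\<forall>\<Gamma>\<in>set \<Gamma>s. provable \<Sigma> \<Gamma>" and "\<forall>A\<in>#\<Phi>. wf_form \<Sigma> A"
  shows "provable \<Sigma> \<Phi>"
proof -
  \<comment> \<open>The function \<open>d\<close> picks one closed proof per sequent, so equal
    premises share a proof.\<close>
  obtain d where d: "\<forall>\<Gamma>\<in>set \<Gamma>s. gs1cut_derivation \<Sigma> (d \<Gamma>) \<and> open_leaves (d \<Gamma>) = [] \<and> conclusion (d \<Gamma>) = \<Gamma>"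
    using assms(2) unfolding provable_def by metis
  have "map conclusion (map d \<Gamma>s) = \<Gamma>s"
    using d by (auto simp: map_idI)
  then have "gs1cut_derivation \<Sigma> (Infer \<Phi> (map d \<Gamma>s))" "open_leaves (Infer \<Phi> (map d \<Gamma>s)) = []"
    using assms d by auto
  then show ?thesis
    unfolding provable_def by (metis conclusion.simps(2))
qed

text \<open>Derivations check well-formedness at the root, so entailments carry the well-formedness
  of both sides with them.\<close>

lemma provable_wf:
  assumes "provable \<Sigma> \<Phi>" and "A \<in># \<Phi>"
  shows "wf_form \<Sigma> A"
proof -
  obtain D where "gs1cut_derivation \<Sigma> D" "conclusion D = \<Phi>"
    using assms(1) unfolding provable_def by blast
  then show ?thesis using assms(2) by (cases D) auto
qed

definition entails :: "('f, 'p) signature \<Rightarrow> ('f, 'p) form \<Rightarrow> ('f, 'p) form \<Rightarrow> bool" where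
  "entails \<Sigma> A B \<longleftrightarrow> provable \<Sigma> {#dual A, B#}"

lemma entails_wf:
  assumes "entails \<Sigma> A B"
  shows "wf_form \<Sigma> A" "wf_form \<Sigma> B"
  using assms provable_wf[of \<Sigma> "{#dual A, B#}"] unfolding entails_def by force+

text \<open>Contraposition. Through it most facts about conjunction and universal quantification
  follow from those about disjunction and existential quantification.\<close>

lemma entails_dual_iff: "entails \<Sigma> (dual A) (dual B) \<longleftrightarrow> entails \<Sigma> B A"
  by (simp add: entails_def add_mset_commute)

lemma provable_Ax: "wf_form \<Sigma> A \<Longrightarrow> provable \<Sigma> {#A, dual A#}"
  by (rule provable_rule[OF Ax]) auto

lemma entails_refl: "wf_form \<Sigma> A \<Longrightarrow> entails \<Sigma> A A"
  using provable_Ax[of \<Sigma> A] by (simp add: entails_def add_mset_commute)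

text \<open>A single cut on \<open>B\<close>.\<close>

lemma entails_trans [trans]:
  assumes "entails \<Sigma> A B" and "entails \<Sigma> B C"
  shows "entails \<Sigma> A C"
  unfolding entails_def
  using provable_rule[OF Cut[of B "{#dual A#}" "{#C#}"], of \<Sigma>] assms entails_wf[OF assms(1)]
    entails_wf[OF assms(2)]
  by (auto simp: entails_def add_mset_commute)

section \<open>The Boolean operations as bounds\<close>

lemma FBot_entails: "wf_form \<Sigma> A \<Longrightarrow> entails \<Sigma> FBot A"
  unfolding entails_def
  using provable_rule[OF RW[of "{#FTop#}" A], of \<Sigma>] provable_rule[OF Top, of \<Sigma>]
  by (auto simp: add_mset_commute)

lemma entails_FOr1:
  assumes "wf_form \<Sigma> A" "wf_form \<Sigma> B"
  shows "entails \<Sigma> A (FOr A B)"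
proof -
  have "provable \<Sigma> {#B, A, dual A#}"
    using assms provable_Ax[of \<Sigma> A] by (intro provable_rule[OF RW]) auto
  then show ?thesis
    using assms provable_rule[OF ROr[of A B "{#dual A#}"], of \<Sigma>]
    by (auto simp: entails_def add_mset_commute)
qed

lemma entails_FOr2:
  assumes "wf_form \<Sigma> A" "wf_form \<Sigma> B"
  shows "entails \<Sigma> B (FOr A B)"
proof -
  have "provable \<Sigma> {#A, B, dual B#}"
    using assms provable_Ax[of \<Sigma> B] by (intro provable_rule[OF RW]) auto
  then show ?thesis
    using assms provable_rule[OF ROr[of A B "{#dual B#}"], of \<Sigma>]
    by (auto simp: entails_def add_mset_commute)
qed

lemma FOr_least:
  assumes "entails \<Sigma> A C" and "entails \<Sigma> B C"
  shows "entails \<Sigma> (FOr A B) C"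
proof -
  \<comment> \<open>\<open>RAnd\<close> joins two separate contexts, so \<open>C\<close> comes along
    twice and is then contracted.\<close>
  have "provable \<Sigma> {#FAnd (dual A) (dual B), C, C#}"
    using assms provable_rule[OF RAnd[of "dual A" "{#C#}" "dual B" "{#C#}"], of \<Sigma>]
      entails_wf[OF assms(1)] entails_wf[OF assms(2)]
    by (auto simp: entails_def)
  then show ?thesis
    using provable_rule[OF RC[of C "{#FAnd (dual A) (dual B)#}"], of \<Sigma>]
      entails_wf[OF assms(1)] entails_wf[OF assms(2)]
    by (auto simp: entails_def add_mset_commute)
qed

lemma entails_FTop: "wf_form \<Sigma> A \<Longrightarrow> entails \<Sigma> A FTop"
  using FBot_entails[of \<Sigma> "dual A"] entails_dual_iff[of \<Sigma> FTop A] by simp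

lemma FAnd_entails1: "wf_form \<Sigma> A \<Longrightarrow> wf_form \<Sigma> B \<Longrightarrow> entails \<Sigma> (FAnd A B) A"
  using entails_FOr1[of \<Sigma> "dual A" "dual B"] entails_dual_iff[of \<Sigma> A "FAnd A B"] by simp

lemma FAnd_entails2: "wf_form \<Sigma> A \<Longrightarrow> wf_form \<Sigma> B \<Longrightarrow> entails \<Sigma> (FAnd A B) B"
  using entails_FOr2[of \<Sigma> "dual A" "dual B"] entails_dual_iff[of \<Sigma> B "FAnd A B"] by simp

lemma FAnd_greatest: "entails \<Sigma> C A \<Longrightarrow> entails \<Sigma> C B \<Longrightarrow> entails \<Sigma> C (FAnd A B)"
  using FOr_least[of \<Sigma> "dual A" "dual C" "dual B"] entails_dual_iff[of \<Sigma> "FAnd A B" C]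
  by (simp add: entails_dual_iff)

text \<open>Residuation: conjunction with \<open>B\<close> is left adjoint to implication from
  \<open>B\<close>, written as a disjunction with \<open>dual B\<close>. It moves a side formula out
  of the way before a join or an existential on the left is treated.\<close>

lemma FAnd_entails_iff:
  assumes wf: "wf_form \<Sigma> A" "wf_form \<Sigma> B" "wf_form \<Sigma> C"
  shows "entails \<Sigma> (FAnd A B) C \<longleftrightarrow> entails \<Sigma> A (FOr (dual B) C)"
proof
  assume AB: "entails \<Sigma> (FAnd A B) C"
  \<comment> \<open>Unit of the adjunction: \<open>A\<close> entails that \<open>B\<close> implies
    \<open>FAnd A B\<close>.\<close>
  have "provable \<Sigma> {#FAnd A B, dual A, dual B#}"
    using wf provable_Ax[of \<Sigma> A] provable_Ax[of \<Sigma> B]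
      provable_rule[OF RAnd[of A "{#dual A#}" B "{#dual B#}"], of \<Sigma>]
    by (auto simp: add_mset_commute)
  then have "entails \<Sigma> A (FOr (dual B) (FAnd A B))"
    using wf provable_rule[OF ROr[of "dual B" "FAnd A B" "{#dual A#}"], of \<Sigma>]
    by (auto simp: entails_def add_mset_commute)
  moreover have "entails \<Sigma> (FOr (dual B) (FAnd A B)) (FOr (dual B) C)"
    using wf AB by (meson FOr_least entails_FOr1 entails_FOr2 entails_trans wf_form_dual)
  ultimately show "entails \<Sigma> A (FOr (dual B) C)"
    by (rule entails_trans)
next
  assume A: "entails \<Sigma> A (FOr (dual B) C)"
  \<comment> \<open>Counit of the adjunction, that is modus ponens: \<open>FAnd B (dual C)\<close>
    is the dual of the implication.\<close>
  have "provable \<Sigma> {#FAnd B (dual C), dual B, C#}"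
    using wf provable_Ax[of \<Sigma> B] provable_Ax[of \<Sigma> "dual C"]
      provable_rule[OF RAnd[of B "{#dual B#}" "dual C" "{#C#}"], of \<Sigma>]
    by (auto simp: add_mset_commute)
  then have "entails \<Sigma> (FAnd (FOr (dual B) C) B) C"
    using wf provable_rule[OF ROr[of "FAnd B (dual C)" "dual B" "{#C#}"], of \<Sigma>]
    by (auto simp: entails_def)
  moreover have "entails \<Sigma> (FAnd A B) (FAnd (FOr (dual B) C) B)"
    using wf A by (meson FAnd_greatest FAnd_entails1 FAnd_entails2 entails_trans)
  ultimately show "entails \<Sigma> (FAnd A B) C"
    by (blast intro: entails_trans)
qed

lemma FAnd_dual_entails: "wf_form \<Sigma> A \<Longrightarrow> entails \<Sigma> (FAnd A (dual A)) FBot"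
  by (simp add: FAnd_entails_iff entails_FOr1)

lemma entails_FOr_dual: "wf_form \<Sigma> A \<Longrightarrow> entails \<Sigma> FTop (FOr A (dual A))"
  using FAnd_dual_entails[of \<Sigma> "dual A"] entails_dual_iff[of \<Sigma> "FOr A (dual A)" FTop] by simp

text \<open>Residuation moves \<open>B\<close> to the right; what remains on the left is a join, so
  \<open>A\<close> and \<open>C\<close> can be treated separately.\<close>

lemma FAnd_FOr_switch:
  assumes "wf_form \<Sigma> A" "wf_form \<Sigma> B" "wf_form \<Sigma> C"
  shows "entails \<Sigma> (FAnd (FOr A C) B) (FOr (FAnd A B) C)"
proof -
  let ?V = "FOr (FAnd A B) C"
  have "entails \<Sigma> A (FOr (dual B) ?V)"
    using assms FAnd_entails_iff[of \<Sigma> A B ?V] entails_FOr1[of \<Sigma> "FAnd A B" C] by simp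
  moreover have "entails \<Sigma> C (FOr (dual B) ?V)"
    using assms entails_FOr2[of \<Sigma> "FAnd A B" C] entails_FOr2[of \<Sigma> "dual B" ?V]
    by (auto intro: entails_trans)
  ultimately show ?thesis
    using assms by (simp add: FAnd_entails_iff FOr_least)
qed

section \<open>Quantifiers as bounds over instances\<close>

lemma entails_FEx:
  assumes "free_for_form t x A" "wf_form \<Sigma> (subst_form x t A)" "wf_form \<Sigma> A"
  shows "entails \<Sigma> (subst_form x t A) (FEx x A)"
  using assms provable_Ax[of \<Sigma> "subst_form x t A"]
    provable_rule[OF REx[OF assms(1), of "{#dual (subst_form x t A)#}"], of \<Sigma>]
  by (auto simp: entails_def add_mset_commute)

lemma entails_FEx_same: "wf_form \<Sigma> A \<Longrightarrow> entails \<Sigma> A (FEx x A)"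
  using entails_FEx[of "Var x" x A \<Sigma>] by simp

text \<open>\<open>RAll\<close> on the dual of \<open>A\<close>: the freshness hypotheses on
  \<open>y\<close> are exactly the eigenvariable condition.\<close>

lemma FEx_least:
  assumes "entails \<Sigma> (subst_form x (Var y) A) C"
    and "free_for_form (Var y) x A" "y \<notin> fv_form (FEx x A)" "y \<notin> fv_form C"
  shows "entails \<Sigma> (FEx x A) C"
proof -
  have "free_for_form (Var y) x (dual A)" "y \<notin> fv_sequent (add_mset (FAll x (dual A)) {#C#})"
    using assms by (auto simp: fv_sequent_def)
  from provable_rule[OF RAll[OF this], of \<Sigma>] show ?thesis
    using assms(1) entails_wf[OF assms(1)] by (auto simp: entails_def)
qed

lemma FEx_least_same:
  "entails \<Sigma> A C \<Longrightarrow> x \<notin> fv_form C \<Longrightarrow> entails \<Sigma> (FEx x A) C"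
  using FEx_least[of \<Sigma> x x A C] by simp

text \<open>No condition on \<open>x\<close> arises, because an entailment is proved without open
  premises and \<open>x\<close> may be generalised in it. This is what makes capture by contexts
  harmless.\<close>

lemma FEx_mono:
  assumes "entails \<Sigma> A B"
  shows "entails \<Sigma> (FEx x A) (FEx x B)"
proof (rule FEx_least_same)
  show "entails \<Sigma> A (FEx x B)"
    using assms entails_FEx_same[OF entails_wf(2)[OF assms]] by (blast intro: entails_trans)
qed simp

lemma FAll_mono: "entails \<Sigma> A B \<Longrightarrow> entails \<Sigma> (FAll x A) (FAll x B)"
  using FEx_mono[of \<Sigma> "dual B" "dual A" x] entails_dual_iff[of \<Sigma> "FAll x B" "FAll x A"]
  by (simp add: entails_dual_iff)

lemma FAll_entails:
  assumes "free_for_form t x A" "wf_form \<Sigma> (subst_form x t A)" "wf_form \<Sigma> A"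
  shows "entails \<Sigma> (FAll x A) (subst_form x t A)"
  using assms entails_FEx[of t x "dual A" \<Sigma>]
    entails_dual_iff[of \<Sigma> "subst_form x t A" "FAll x A"] by simp

lemma FAnd_FEx_FAll_entails:
  assumes "wf_form \<Sigma> A" "wf_form \<Sigma> B"
  shows "entails \<Sigma> (FAnd (FEx x A) (FAll x B)) (FEx x (FAnd A B))"
proof -
  have "entails \<Sigma> (FAll x B) B"
    using FAll_entails[of "Var x" x B \<Sigma>] assms by simp
  then have "entails \<Sigma> (FAnd A (FAll x B)) (FAnd A B)"
    using assms by (meson FAnd_entails1 FAnd_entails2 FAnd_greatest entails_trans wf_form.simps(7))
  then have "entails \<Sigma> (FAnd A (FAll x B)) (FEx x (FAnd A B))"
    using assms by (meson entails_FEx_same entails_trans wf_form.simps(4))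
  \<comment> \<open>Since \<open>x\<close> is free neither in \<open>FAll x B\<close> nor in the
    target, it can be the eigenvariable once \<open>FAll x B\<close> has moved to the right.\<close>
  then have "entails \<Sigma> (FEx x A) (FOr (dual (FAll x B)) (FEx x (FAnd A B)))"
    using assms by (intro FEx_least_same) (simp_all add: FAnd_entails_iff)
  then show ?thesis
    using assms by (simp add: FAnd_entails_iff)
qed

lemma FAll_FOr_entails:
  assumes "wf_form \<Sigma> A" "wf_form \<Sigma> B"
  shows "entails \<Sigma> (FAll x (FOr A B)) (FOr (FAll x A) (FEx x B))"
  using assms FAnd_FEx_FAll_entails[of \<Sigma> "dual A" "dual B" x]
    entails_dual_iff[of \<Sigma> "FOr (FAll x A) (FEx x B)" "FAll x (FOr A B)"] by simp

section \<open>Mutual entailment and change of bound variables\<close>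

definition equivalent :: "('f, 'p) signature \<Rightarrow> ('f, 'p) form \<Rightarrow> ('f, 'p) form \<Rightarrow> bool" where
  "equivalent \<Sigma> A B \<longleftrightarrow> entails \<Sigma> A B \<and> entails \<Sigma> B A"

lemma equivalent_refl: "wf_form \<Sigma> A \<Longrightarrow> equivalent \<Sigma> A A"
  by (simp add: equivalent_def entails_refl)

lemma equivalent_dual_iff: "equivalent \<Sigma> (dual A) (dual B) \<longleftrightarrow> equivalent \<Sigma> A B"
  by (auto simp: equivalent_def entails_dual_iff)

lemma FEx_vacuous:
  assumes "wf_form \<Sigma> A" "x \<notin> fv_form A"
  shows "equivalent \<Sigma> (FEx x A) A"
  using assms by (simp add: equivalent_def FEx_least_same entails_FEx_same entails_refl)

lemma FAll_vacuous:
  assumes "wf_form \<Sigma> A" "x \<notin> fv_form A"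
  shows "equivalent \<Sigma> (FAll x A) A"
  using assms FEx_vacuous[of \<Sigma> "dual A" x] equivalent_dual_iff[of \<Sigma> "FAll x A" A] by simp

lemma FEx_rename:
  assumes wf: "wf_form \<Sigma> A" and "y \<notin> fv_form A" "free_for_form (Var y) x A"
  shows "equivalent \<Sigma> (FEx x A) (FEx y (subst_form x (Var y) A))"
  unfolding equivalent_def
proof
  \<comment> \<open>In both directions \<open>y\<close> is the eigenvariable; it is then the witness
    for the bound \<open>y\<close> here and for \<open>x\<close> below.\<close>
  show "entails \<Sigma> (FEx x A) (FEx y (subst_form x (Var y) A))"
    by (rule FEx_least[of _ _ y]) (use assms in \<open>auto intro: entails_FEx_same\<close>)
  show "entails \<Sigma> (FEx y (subst_form x (Var y) A)) (FEx x A)"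
    by (rule FEx_least_same) (use assms in \<open>auto intro: entails_FEx\<close>)
qed

lemma FAll_rename:
  assumes "wf_form \<Sigma> A" and "y \<notin> fv_form A" "free_for_form (Var y) x A"
  shows "equivalent \<Sigma> (FAll x A) (FAll y (subst_form x (Var y) A))"
  using assms FEx_rename[of \<Sigma> "dual A" y x]
    equivalent_dual_iff[of \<Sigma> "FAll x A" "FAll y (subst_form x (Var y) A)"] by simp


section \<open>Translation of arbitrary structures\<close>

fun FOrs :: "('f, 'p) form list \<Rightarrow> ('f, 'p) form" where
  "FOrs [] = FBot"
| "FOrs [A] = A"
| "FOrs (A # B # As) = FOr A (FOrs (B # As))"

lemma fv_form_FOrs [simp]: "fv_form (FOrs As) = (\<Union>A\<in>set As. fv_form A)"
  by (induction As rule: FOrs.induct) auto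

lemma wf_form_FOrs [simp]: "wf_form \<Sigma> (FOrs As) \<longleftrightarrow> (\<forall>A\<in>set As. wf_form \<Sigma> A)"
  by (induction As rule: FOrs.induct) auto

lemma subst_form_FOrs [simp]: "subst_form x t (FOrs As) = FOrs (map (subst_form x t) As)"
  by (induction As rule: FOrs.induct) auto

lemma free_for_form_FOrs [simp]:
  "free_for_form t x (FOrs As) \<longleftrightarrow> (\<forall>A\<in>set As. free_for_form t x A)"
  by (induction As rule: FOrs.induct) auto

lemma FOrs_least: "\<forall>A\<in>set As. entails \<Sigma> A C \<Longrightarrow> wf_form \<Sigma> C \<Longrightarrow> entails \<Sigma> (FOrs As) C"
  by (induction As rule: FOrs.induct) (auto intro: FBot_entails FOr_least)

lemma entails_FOrs: "A \<in> set As \<Longrightarrow> \<forall>B\<in>set As. wf_form \<Sigma> B \<Longrightarrow> entails \<Sigma> A (FOrs As)"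
proof (induction As rule: FOrs.induct)
  case (3 B C As)
  show ?case
  proof (cases "A = B")
    case True
    then show ?thesis using 3 by (auto intro: entails_FOr1)
  next
    case False
    then have "entails \<Sigma> A (FOrs (C # As))" using 3 by auto
    moreover have "entails \<Sigma> (FOrs (C # As)) (FOrs (B # C # As))"
      using 3 by (auto intro: entails_FOr2)
    ultimately show ?thesis by (rule entails_trans)
  qed
qed (auto intro: entails_refl)

text \<open>The lists are compared as sets, each entry on the left choosing its own bound on the
  right; this covers both replacing an entry and regrouping.\<close>

lemma FOrs_mono:
  assumes "\<forall>A\<in>set As. \<exists>B\<in>set Bs. entails \<Sigma> A B" and "\<forall>B\<in>set Bs. wf_form \<Sigma> B"
  shows "entails \<Sigma> (FOrs As) (FOrs Bs)"
proof (rule FOrs_least)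
  show "\<forall>A\<in>set As. entails \<Sigma> A (FOrs Bs)"
    using assms by (meson entails_FOrs entails_trans)
qed (simp add: assms)

lemma FOrs_mono_nth:
  assumes "entails \<Sigma> A B" and "\<forall>C\<in>set As \<union> set Cs. wf_form \<Sigma> C"
  shows "entails \<Sigma> (FOrs (As @ A # Cs)) (FOrs (As @ B # Cs))"
proof (rule FOrs_mono)
  show "\<forall>C\<in>set (As @ A # Cs). \<exists>D\<in>set (As @ B # Cs). entails \<Sigma> C D"
    using assms by (auto intro: entails_refl)
qed (use assms entails_wf[OF assms(1)] in auto)

text \<open>Both sides are least upper bounds of the entries of \<open>As\<close>, \<open>Bs\<close>
  and \<open>Cs\<close>.\<close>

lemma FOrs_assoc:
  assumes wf: "\<forall>A\<in>set (As @ Bs @ Cs). wf_form \<Sigma> A"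
  shows "equivalent \<Sigma> (FOrs (As @ FOrs Bs # Cs)) (FOrs (As @ Bs @ Cs))"
  unfolding equivalent_def
proof
  have "entails \<Sigma> (FOrs Bs) (FOrs (As @ Bs @ Cs))"
    using wf by (intro FOrs_mono) (auto intro: entails_refl)
  then show "entails \<Sigma> (FOrs (As @ FOrs Bs # Cs)) (FOrs (As @ Bs @ Cs))"
    using wf by (intro FOrs_least) (auto intro: entails_FOrs)
  have wf': "\<forall>A\<in>set (As @ FOrs Bs # Cs). wf_form \<Sigma> A"
    using wf by auto
  have "entails \<Sigma> B (FOrs (As @ FOrs Bs # Cs))" if "B \<in> set Bs" for B
  proof (rule entails_trans)
    show "entails \<Sigma> B (FOrs Bs)" using that wf by (auto intro: entails_FOrs)
    show "entails \<Sigma> (FOrs Bs) (FOrs (As @ FOrs Bs # Cs))"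
      using wf' by (intro entails_FOrs) auto
  qed
  then show "entails \<Sigma> (FOrs (As @ Bs @ Cs)) (FOrs (As @ FOrs Bs # Cs))"
    using wf' by (intro FOrs_least) (auto intro: entails_FOrs[OF _ wf'])
qed

text \<open>Structures inside a derivation need not be \<open>translatable\<close>, so
  \<open>to_form\<close> is extended to all structures. Conjunctions are De Morgan duals of
  disjunctions, which lets the facts on \<open>FOrs\<close> serve for both.\<close>

fun trans_str :: "('f, 'p) str \<Rightarrow> ('f, 'p) form" where
  "trans_str Ff = FBot"
| "trans_str Tt = FTop"
| "trans_str (At a) = FAt a"
| "trans_str (Disj Rs) = FOrs (map trans_str Rs)"
| "trans_str (Conj Rs) = dual (FOrs (map (\<lambda>R. dual (trans_str R)) Rs))"
| "trans_str (Bar R) = dual (trans_str R)"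
| "trans_str (SEx x R) = FEx x (trans_str R)"
| "trans_str (SAll x R) = FAll x (trans_str R)"

text \<open>The equality is literal: the singleton clause of \<open>FOrs\<close> keeps a spurious
  \<open>FBot\<close> out of binary disjunctions, and double duals cancel.\<close>

lemma trans_str_eq_to_form: "translatable R \<Longrightarrow> trans_str R = to_form R"
  by (induction R rule: to_form.induct) auto

lemma wf_form_trans_str: "wf_str \<Sigma> R \<Longrightarrow> wf_form \<Sigma> (trans_str R)"
  by (induction R) auto

lemma fv_form_trans_str [simp]: "fv_form (trans_str R) = fv_str R"
  by (induction R) auto

lemma free_for_form_trans_str [simp]: "free_for_form t x (trans_str R) = free_for_str t x R"
  by (induction R) auto

lemma trans_str_subst_str [simp]: "trans_str (subst_str x t R) = subst_form x t (trans_str R)"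
  by (induction R) (simp_all add: comp_def cong: map_cong)

section \<open>Soundness of contexts, equivalence and rules\<close>

lemma wf_str_fill_cong: "(wf_str \<Sigma> R \<longleftrightarrow> wf_str \<Sigma> T) \<Longrightarrow> wf_str \<Sigma> (fill S R) \<longleftrightarrow> wf_str \<Sigma> (fill S T)"
  by (induction S) auto

lemma wf_str_fillD: "wf_str \<Sigma> (fill S R) \<Longrightarrow> wf_str \<Sigma> R"
  by (induction S) auto

text \<open>The structures to which a rule applies are given only up to equivalence; this yields
  their well-formedness. In the associativity cases \<open>Ts\<close> must be non-empty, as an empty
  inner list is ill-formed only before flattening.\<close>

lemma str_equiv_wf_iff: "R \<simeq> T \<Longrightarrow> wf_str \<Sigma> R \<longleftrightarrow> wf_str \<Sigma> T"
proof (induction rule: str_equiv.induct)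
  case (ctx_closure R T S)
  from ctx_closure.IH show ?case by (rule wf_str_fill_cong)
qed auto

text \<open>Joins, meets and quantifiers preserve the order, and no context puts its hole under a
  bar, which would reverse it.\<close>

lemma entails_fill:
  assumes "entails \<Sigma> (trans_str R) (trans_str T)" and "wf_str \<Sigma> (fill S R)" "wf_str \<Sigma> (fill S T)"
  shows "entails \<Sigma> (trans_str (fill S R)) (trans_str (fill S T))"
  using assms(2,3)
proof (induction S)
  case Hole
  then show ?case using assms(1) by simp
next
  case (CDisj Rs S Us)
  then show ?case
    by (auto intro!: FOrs_mono_nth wf_form_trans_str)
next
  \<comment> \<open>Contraposing twice, for the outer \<open>dual\<close> and for the
    \<open>dual\<close> at the entry, reduces this to the disjunctive case.\<close>
  case (CConj Rs S Us)
  then show ?case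
    by (auto simp: entails_dual_iff intro!: FOrs_mono_nth wf_form_trans_str)
next
  case (CEx x S)
  then show ?case by (simp add: FEx_mono)
next
  case (CAll x S)
  then show ?case by (simp add: FAll_mono)
qed

lemma str_equiv_imp_equivalent:
  "R \<simeq> T \<Longrightarrow> wf_str \<Sigma> R \<Longrightarrow> equivalent \<Sigma> (trans_str R) (trans_str T)"
proof (induction rule: str_equiv.induct)
  case (sym R T)
  then show ?case using str_equiv_wf_iff by (auto simp: equivalent_def)
next
  case (trans R T U)
  then show ?case using str_equiv_wf_iff by (auto simp: equivalent_def intro: entails_trans)
next
  case (Disj_assoc Ts Rs Us)
  then show ?case
    using FOrs_assoc[of "map trans_str Rs" "map trans_str Ts" "map trans_str Us" \<Sigma>]
    by (auto intro: wf_form_trans_str)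
next
  case (Conj_assoc Ts Rs Us)
  let ?d = "\<lambda>R. dual (trans_str R)"
  from Conj_assoc show ?case
    using FOrs_assoc[of "map ?d Rs" "map ?d Ts" "map ?d Us" \<Sigma>]
    by (fastforce simp: equivalent_dual_iff intro: wf_form_trans_str)
next
  case (Disj_comm R T)
  then show ?case
    by (auto simp: equivalent_def intro: FOr_least entails_FOr1 entails_FOr2 wf_form_trans_str)
next
  case (Conj_comm R T)
  then show ?case
    by (auto simp: equivalent_def intro: FAnd_greatest FAnd_entails1 FAnd_entails2 wf_form_trans_str)
next
  case Conj_ff
  show ?case by (auto simp: equivalent_def intro: FBot_entails FAnd_entails1)
next
  case (Disj_unit R)
  then show ?case
    by (auto simp: equivalent_def
        intro: FOr_least entails_FOr2 FBot_entails entails_refl wf_form_trans_str)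
next
  case Disj_tt
  show ?case by (auto simp: equivalent_def intro: entails_FTop entails_FOr1)
next
  case (Conj_unit R)
  then show ?case
    by (auto simp: equivalent_def
        intro: FAnd_greatest FAnd_entails2 entails_FTop entails_refl wf_form_trans_str)
next
  case (ctx_closure R T S)
  have "wf_str \<Sigma> R" "wf_str \<Sigma> (fill S T)"
    using ctx_closure wf_str_fillD str_equiv_wf_iff str_equiv.ctx_closure by blast+
  then show ?case
    using ctx_closure by (auto simp: equivalent_def intro: entails_fill)
\<comment> \<open>The negation equations become syntactic identities under \<open>trans_str\<close>,
  \<open>neg_closure\<close> is contraposition, and the quantifier equations are the renaming and
  vacuity lemmas.\<close>
qed (simp_all add: equivalent_dual_iff wf_form_trans_str equivalent_refl
      FAll_rename FEx_rename FAll_vacuous FEx_vacuous)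

text \<open>Stripping the context by \<open>entails_fill\<close> leaves, for each rule, one fact
  about the order.\<close>

lemma sksgq_rule_imp_entails:
  assumes "sksgq_rule A B" and "wf_str \<Sigma> A" "wf_str \<Sigma> B"
  shows "entails \<Sigma> (trans_str A) (trans_str B)"
proof -
  note [simp] = wf_form_trans_str
  show ?thesis
    using assms
  proof cases
    case (i_down S R)
    \<comment> \<open>Here and below, a structure seen on only one side of a rule gets its
      well-formedness from that side.\<close>
    have "wf_str \<Sigma> R" using wf_str_fillD assms i_down by fastforce
    then show ?thesis using assms i_down by (auto intro!: entails_fill entails_FOr_dual)
  next
    case (i_up S R)
    have "wf_str \<Sigma> R" using wf_str_fillD assms i_up by fastforce
    then show ?thesis using assms i_up by (auto intro!: entails_fill FAnd_dual_entails)
  next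
    case (switch S R U T)
    have "wf_str \<Sigma> (Disj [Conj [R, T], U])" using wf_str_fillD assms switch by fastforce
    then show ?thesis using assms switch by (auto intro!: entails_fill FAnd_FOr_switch)
  next
    case (w_down S R)
    have "wf_str \<Sigma> R" using wf_str_fillD assms w_down by fastforce
    then show ?thesis using assms w_down by (auto intro!: entails_fill FBot_entails)
  next
    case (w_up S R)
    have "wf_str \<Sigma> R" using wf_str_fillD assms w_up by fastforce
    then show ?thesis using assms w_up by (auto intro!: entails_fill entails_FTop)
  next
    case (c_down S R)
    have "wf_str \<Sigma> R" using wf_str_fillD assms c_down by fastforce
    then show ?thesis using assms c_down by (auto intro!: entails_fill FOr_least entails_refl)
  next
    case (c_up S R)
    have "wf_str \<Sigma> R" using wf_str_fillD assms c_up by fastforce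
    then show ?thesis using assms c_up by (auto intro!: entails_fill FAnd_greatest entails_refl)
  next
    case (u_down S x R T)
    have "wf_str \<Sigma> (SAll x (Disj [R, T]))" using wf_str_fillD assms u_down by fastforce
    then show ?thesis using assms u_down by (auto intro!: entails_fill FAll_FOr_entails)
  next
    case (u_up S x R T)
    have "wf_str \<Sigma> (SEx x (Conj [R, T]))" using wf_str_fillD assms u_up by fastforce
    then show ?thesis using assms u_up by (auto intro!: entails_fill FAnd_FEx_FAll_entails)
  next
    case (n_down t x R S)
    \<comment> \<open>Nothing is known about \<open>t\<close> itself: the instance is well-formed by
      the premise, and \<open>R\<close> by the conclusion.\<close>
    have "wf_str \<Sigma> (subst_str x t R)" "wf_str \<Sigma> (SEx x R)"
      using wf_str_fillD assms n_down by fastforce+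
    then show ?thesis
      using assms n_down wf_form_trans_str[of \<Sigma> "subst_str x t R"]
      by (auto intro!: entails_fill entails_FEx)
  next
    case (n_up t x R S)
    have "wf_str \<Sigma> (subst_str x t R)" "wf_str \<Sigma> (SAll x R)"
      using wf_str_fillD assms n_up by fastforce+
    then show ?thesis
      using assms n_up wf_form_trans_str[of \<Sigma> "subst_str x t R"]
      by (auto intro!: entails_fill FAll_entails)
  qed
qed

lemma sksgq_derivation_imp_entails:
  assumes "sksgq_derivation \<Sigma> \<Delta>"
  shows "entails \<Sigma> (trans_str (hd \<Delta>)) (trans_str (last \<Delta>))"
proof -
  have wf: "wf_str \<Sigma> (\<Delta> ! i)" if "i < length \<Delta>" for i
    using assms that by (auto simp: sksgq_derivation_def)
  \<comment> \<open>Induction on the position; a derivation of a single structure is the base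
    case.\<close>
  have "entails \<Sigma> (trans_str (\<Delta> ! 0)) (trans_str (\<Delta> ! i))" if "i < length \<Delta>" for i
    using that
  proof (induction i)
    case 0
    then show ?case using wf by (auto intro: entails_refl wf_form_trans_str)
  next
    case (Suc i)
    then obtain A B where AB: "\<Delta> ! i \<simeq> A" "sksgq_rule A B" "B \<simeq> \<Delta> ! Suc i"
      using assms by (auto simp: sksgq_derivation_def)
    have wfAB: "wf_str \<Sigma> A" "wf_str \<Sigma> B"
      using AB str_equiv_wf_iff wf Suc.prems Suc_lessD by blast+
    have "entails \<Sigma> (trans_str (\<Delta> ! 0)) (trans_str (\<Delta> ! i))"
      using Suc by simp
    also have "entails \<Sigma> (trans_str (\<Delta> ! i)) (trans_str A)"
      using str_equiv_imp_equivalent[OF AB(1)] wf Suc.prems by (auto simp: equivalent_def)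
    also have "entails \<Sigma> (trans_str A) (trans_str B)"
      using sksgq_rule_imp_entails AB(2) wfAB by blast
    also have "entails \<Sigma> (trans_str B) (trans_str (\<Delta> ! Suc i))"
      using str_equiv_imp_equivalent[OF AB(3)] wfAB by (auto simp: equivalent_def)
    finally show ?case .
  qed
  moreover have "\<Delta> \<noteq> []" using assms by (simp add: sksgq_derivation_def)
  ultimately show ?thesis by (simp add: hd_conv_nth last_conv_nth)
qed

theorem theorem4p8:
  fixes \<Sigma> :: "('f, 'p) signature"
    and \<Delta> :: "('f, 'p) str list"
    and Q P :: "('f, 'p) str"
  assumes "sksgq_derivation_from_to \<Sigma> \<Delta> Q P"
    and "translatable Q" and "translatable P"
  shows "\<exists>D. gs1cut_derivation \<Sigma> D \<and>
           open_leaves D = [{#to_form Q#}] \<and> conclusion D = {#to_form P#}"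
proof -
  have \<Delta>: "sksgq_derivation \<Sigma> \<Delta>" "hd \<Delta> \<simeq> Q" "last \<Delta> \<simeq> P"
    using assms(1) by (auto simp: sksgq_derivation_from_to_def)
  then have wf: "wf_str \<Sigma> (hd \<Delta>)" "wf_str \<Sigma> (last \<Delta>)"
    by (auto simp: sksgq_derivation_def)
  have "entails \<Sigma> (trans_str Q) (trans_str (hd \<Delta>))"
    using str_equiv_imp_equivalent[OF \<Delta>(2) wf(1)] by (simp add: equivalent_def)
  also have "entails \<Sigma> (trans_str (hd \<Delta>)) (trans_str (last \<Delta>))"
    using sksgq_derivation_imp_entails[OF \<Delta>(1)] .
  also have "entails \<Sigma> (trans_str (last \<Delta>)) (trans_str P)"
    using str_equiv_imp_equivalent[OF \<Delta>(3) wf(2)] by (simp add: equivalent_def)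
  finally have QP: "entails \<Sigma> (to_form Q) (to_form P)"
    using assms by (simp add: trans_str_eq_to_form)
  then obtain D where D: "gs1cut_derivation \<Sigma> D" "open_leaves D = []"
      "conclusion D = {#dual (to_form Q), to_form P#}"
    by (auto simp: entails_def provable_def)
  \<comment> \<open>The cut has an empty context on the left. As \<open>D\<close> is closed, the
    open premise occurs exactly once, even if the derivation is a single structure.\<close>
  let ?D = "Infer {#to_form P#} [Open {#to_form Q#}, D]"
  have "gs1cut_rule [{#to_form Q#}, {#dual (to_form Q), to_form P#}] {#to_form P#}"
    using Cut[of "to_form Q" "{#}" "{#to_form P#}"] by simp
  then have "gs1cut_derivation \<Sigma> ?D"
    using D entails_wf[OF QP] by simp
  then show ?thesis
    using D by (intro exI[of _ ?D]) simp
qed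

end
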